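(* Let $K$ be an algebraically closed field. The following is a complete irredundant list of representatives of the $\mathrm{GL}_3(K)$-orbits in $\mathcal{N}_{3,2}$ (i.e. every $\mathrm{GL}_3(K)$-orbit in $\mathcal{N}_{3,2}$ contains exactly one of the listed pairs, and pairs listed with different names or different parameter values lie in different orbits): \begin{itemize} \item $A_{\lambda,\mu}:=(E_{21}+E_{32},\ \lambda(E_{21}+E_{32})+\mu E_{32})$, $\lambda,\mu\in K$, $\mu\neq 0$; \item $A_{\lambda,\infty}:=(E_{21},\ \lambda E_{21}+E_{32})$, $\lambda\in K$; \item $A_{\infty,\lambda}:=(E_{32},\ E_{21}+\lambda E_{32})$, $\lambda\in K$; \item $B_{\lambda,\mu}:=(E_{21}+E_{32},\ \lambda(E_{21}+E_{32})+\mu E_{31})$, $\lambda,\mu\in K$; \item $B_{\infty,\lambda}:=(\lambda E_{31},\ E_{21}+E_{32})$, $\lambda\in K$; \item $C:=(E_{21},E_{31})$; \item $D:=(E_{31},E_{32})$; \item $E_\lambda:=(E_{21},\lambda E_{21})$, $\lambda\in K$; \item $E_\infty:=(0,E_{21})$; \item $O:=(0,0)$. \end{itemize}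
   Context: $E_{ij}$ denotes the $3\times 3$ matrix unit with entry $1$ in position $(i,j)$ and $0$ elsewhere. $\mathrm{GL}_3(K)$ acts on $(K^{3\times 3})^2$ by simultaneous conjugation, $g\cdot(A_1,A_2)=(gA_1g^{-1},gA_2g^{-1})$. $\mathcal{N}_{3,2}$ is the nullcone: the set of pairs $(A_1,A_2)\in (K^{3\times 3})^2$ such that $A_1,A_2$ generate a nilpotent (non-unital) subalgebra of $K^{3\times 3}$; equivalently, the set of pairs whose $\mathrm{GL}_3(K)$-orbit has $(0,0)$ in its Zariski closure. *)

theory Defs
  imports "HOL-Analysis.Analysis" "HOL-Computational_Algebra.Polynomial"
begin

definition mscale :: "'a::semiring_1 \<Rightarrow> 'a^'n^'m \<Rightarrow> 'a^'n^'m"  (infixr "*\<^sub>m" 75)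
  where "c *\<^sub>m A = (\<chi> i j. c * A $ i $ j)"

definition nonunital_subalgebra :: "('a::field^'n^'n) set \<Rightarrow> bool"
  where "nonunital_subalgebra S \<longleftrightarrow>
    0 \<in> S \<and> (\<forall>A\<in>S. \<forall>B\<in>S. A + B \<in> S) \<and> (\<forall>c. \<forall>A\<in>S. c *\<^sub>m A \<in> S) \<and>
    (\<forall>A\<in>S. \<forall>B\<in>S. A ** B \<in> S)"

text \<open>Nilpotent as an algebra, with one exponent valid for all products of elements of the
  algebra (this is stronger than every element being nilpotent). The exponent is positive
  automatically, since the empty product is the identity matrix.\<close>

definition nilpotent_algebra :: "('a::field^'n^'n) set \<Rightarrow> bool"
  where "nilpotent_algebra S \<longleftrightarrow>
    (\<exists>n. \<forall>As. length As = n \<and> set As \<subseteq> S \<longrightarrow> foldr (**) As (mat 1) = 0)"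

definition nullcone2 :: "(('a::field^'n^'n) \<times> ('a^'n^'n)) set"
  where "nullcone2 = {(A1, A2). nilpotent_algebra (nonunital_subalgebra hull {A1, A2})}"

definition sim_conj ::
    "'a::field^'n^'n \<Rightarrow> ('a^'n^'n) \<times> ('a^'n^'n) \<Rightarrow> ('a^'n^'n) \<times> ('a^'n^'n)"
  where "sim_conj g X = (g ** fst X ** matrix_inv g, g ** snd X ** matrix_inv g)"

definition GL_orbit ::
    "('a::field^'n^'n) \<times> ('a^'n^'n) \<Rightarrow> (('a^'n^'n) \<times> ('a^'n^'n)) set"
  where "GL_orbit X = {sim_conj g X |g. invertible g}"

text \<open>The numeral type \<open>3\<close> has the elements \<open>1, 2, 3\<close> (with \<open>3 = 0\<close>),
  so the usual row and column numbers can be used directly.\<close>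

definition E_unit :: "3 \<Rightarrow> 3 \<Rightarrow> 'a::field^3^3"
  where "E_unit i j = (\<chi> k l. if k = i \<and> l = j then 1 else 0)"

text \<open>One constructor per family; the suffixes \<open>fi\<close> and \<open>if\<close> record which index
  is finite and which is \<open>\<infinity>\<close>: \<open>A_fi \<lambda>\<close> is \<open>A\<close> with indices \<open>\<lambda>, \<infinity>\<close>,
  \<open>A_if \<lambda>\<close> is \<open>A\<close> with indices \<open>\<infinity>, \<lambda>\<close>, and similarly for \<open>B\<close> and \<open>E\<close>.\<close>

datatype 'a label =
    A_ff 'a 'a | A_fi 'a | A_if 'a
  | B_ff 'a 'a | B_if 'a
  | C_lab | D_lab
  | E_f 'a | E_i
  | O_lab

fun admissible :: "'a::field label \<Rightarrow> bool" where
  "admissible (A_ff l m) \<longleftrightarrow> m \<noteq> 0"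
| "admissible _ \<longleftrightarrow> True"

fun representative :: "'a::field label \<Rightarrow> ('a^3^3) \<times> ('a^3^3)" where
  "representative (A_ff l m) =
     (E_unit 2 1 + E_unit 3 2, l *\<^sub>m (E_unit 2 1 + E_unit 3 2) + m *\<^sub>m E_unit 3 2)"
| "representative (A_fi l) = (E_unit 2 1, l *\<^sub>m E_unit 2 1 + E_unit 3 2)"
| "representative (A_if l) = (E_unit 3 2, E_unit 2 1 + l *\<^sub>m E_unit 3 2)"
| "representative (B_ff l m) =
     (E_unit 2 1 + E_unit 3 2, l *\<^sub>m (E_unit 2 1 + E_unit 3 2) + m *\<^sub>m E_unit 3 1)"
| "representative (B_if l) = (l *\<^sub>m E_unit 3 1, E_unit 2 1 + E_unit 3 2)"
| "representative C_lab = (E_unit 2 1, E_unit 3 1)"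
| "representative D_lab = (E_unit 3 1, E_unit 3 2)"
| "representative (E_f l) = (E_unit 2 1, l *\<^sub>m E_unit 2 1)"
| "representative E_i = (0, E_unit 2 1)"
| "representative O_lab = (0, 0)"

end

theory Submission
  imports Defs
begin

text \<open>
  A pair in the nullcone can be made strictly lower triangular by one change of basis. Indeed, let
  \<open>P\<close> be a nonzero product of maximal length of elements of the nilpotent algebra generated by the
  pair. The algebra kills \<open>P\<close> from both sides and \<open>P\<^sup>2 = 0\<close>, so a nonzero column \<open>v\<close> and a nonzero
  row \<open>u\<close> of \<open>P\<close> can be chosen with \<open>u v = 0\<close>. The algebra kills \<open>v\<close> from the left and \<open>u\<close> from
  the right; in a basis where \<open>v\<close> is the last basis vector and \<open>u\<close> the first coordinate form, only
  the middle diagonal entries separate the pair from strictly lower triangular form, and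
  nilpotency makes them vanish (\<open>nullcone_triangularizable\<close>).

  A strictly lower triangular pair \<open>A\<^sub>i = a\<^sub>i E\<^sub>2\<^sub>1 + b\<^sub>i E\<^sub>3\<^sub>2 + c\<^sub>i E\<^sub>3\<^sub>1\<close> amounts to three vectors
  \<open>a\<close>, \<open>b\<close>, \<open>c\<close> in the plane. Conjugation by lower triangular matrices rescales \<open>a\<close> and \<open>b\<close>
  independently and adds multiples of \<open>a\<close> and \<open>b\<close> to \<open>c\<close>. If \<open>a\<close> and \<open>b\<close> are both nonzero, they
  become normalized representatives of two points of the projective line. When the points differ,
  \<open>c\<close> can be cleared, which leaves the families \<open>A\<close>; when they coincide, \<open>c\<close> matters modulo \<open>a\<close>,
  which leaves the families \<open>B\<close>. If \<open>b = 0\<close>, both matrices live in the first column and \<open>a\<close>, \<open>c\<close>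
  can be mixed by an arbitrary invertible \<open>2 \<times> 2\<close> matrix, so that only the row space of the
  matrix with rows \<open>a\<close> and \<open>c\<close> remains: \<open>C\<close> for the whole plane, the family \<open>E\<close> for a line and
  \<open>O\<close> for zero. The case \<open>a = 0\<close> concerns the last row instead and gives \<open>D\<close>, \<open>E\<close> and \<open>O\<close>
  (\<open>normal_form\<close>).

  That different representatives lie in different orbits (\<open>representative_distinct\<close>) follows from
  the linear equations satisfied by the entries of a matrix that intertwines two strictly lower
  triangular pairs.
\<close>

section \<open>Orbits under simultaneous conjugation\<close>

lemma matrix_inv_inverse:
  fixes g :: "'k::field^'n^'n"
  assumes "invertible g"
  shows "g ** matrix_inv g = mat 1" "matrix_inv g ** g = mat 1"
  using assms unfolding invertible_def matrix_inv_def
  by (metis (mono_tags, lifting) someI_ex)+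

text \<open>Clearing the inverse turns orbit membership into equations that are linear in the entries of
  the conjugating matrix.\<close>

lemma GL_orbit_iff:
  fixes X Y :: "('k::field^'n^'n) \<times> ('k^'n^'n)"
  shows "Y \<in> GL_orbit X \<longleftrightarrow>
    (\<exists>g. invertible g \<and> fst Y ** g = g ** fst X \<and> snd Y ** g = g ** snd X)"
proof -
  have conj: "B = g ** A ** matrix_inv g \<longleftrightarrow> B ** g = g ** A"
    if "invertible g" for g A B :: "'k^'n^'n"
  proof -
    have "g ** matrix_inv g = mat 1" "matrix_inv g ** g = mat 1"
      using matrix_inv_inverse[OF that] by auto
    then show ?thesis
      by (metis matrix_mul_assoc matrix_mul_rid)
  qed
  show ?thesis
    unfolding GL_orbit_def sim_conj_def prod_eq_iff mem_Collect_eq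
    using conj by (metis fst_conv snd_conv)
qed

lemma GL_orbit_sym:
  fixes X Y :: "('k::field^'n^'n) \<times> ('k^'n^'n)"
  assumes "Y \<in> GL_orbit X"
  shows "X \<in> GL_orbit Y"
proof -
  obtain g where g: "invertible g" "fst Y ** g = g ** fst X" "snd Y ** g = g ** snd X"
    using assms GL_orbit_iff by blast
  let ?h = "matrix_inv g"
  have h: "g ** ?h = mat 1" "?h ** g = mat 1"
    using matrix_inv_inverse[OF g(1)] by auto
  have "A ** ?h = ?h ** B" if "B ** g = g ** A" for A B
    using that h by (metis matrix_mul_assoc matrix_mul_lid matrix_mul_rid)
  moreover have "invertible ?h"
    using h invertible_def by blast
  ultimately show ?thesis
    unfolding GL_orbit_iff using g by blast
qed

lemma GL_orbit_trans:
  fixes X Y Z :: "('k::field^'n^'n) \<times> ('k^'n^'n)"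
  assumes "Z \<in> GL_orbit Y" "Y \<in> GL_orbit X"
  shows "Z \<in> GL_orbit X"
proof -
  obtain g where g: "invertible g" "fst Z ** g = g ** fst Y" "snd Z ** g = g ** snd Y"
    using assms GL_orbit_iff by blast
  obtain h where h: "invertible h" "fst Y ** h = h ** fst X" "snd Y ** h = h ** snd X"
    using assms GL_orbit_iff by blast
  have "invertible (g ** h)"
    using g(1) h(1) invertible_mult by blast
  moreover have "fst Z ** (g ** h) = (g ** h) ** fst X" "snd Z ** (g ** h) = (g ** h) ** snd X"
    using g h by (metis matrix_mul_assoc)+
  ultimately show ?thesis
    unfolding GL_orbit_iff by blast
qed

lemma GL_orbit_refl:
  fixes X :: "('k::field^'n^'n) \<times> ('k^'n^'n)"
  shows "X \<in> GL_orbit X"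
  unfolding GL_orbit_iff by (intro exI[of _ "mat 1"]) (simp add: invertible_det_nz)

section \<open>Strictly lower triangular pairs\<close>

definition strict_lower :: "'k::field \<Rightarrow> 'k \<Rightarrow> 'k \<Rightarrow> 'k^3^3"
  where "strict_lower a b c = vector [vector [0, 0, 0], vector [a, 0, 0], vector [c, b, 0]]"

lemma strict_lower_entries [simp]:
  "strict_lower a b c $ 1 = 0"
  "strict_lower a b c $ 2 $ 1 = a" "strict_lower a b c $ 2 $ 2 = 0" "strict_lower a b c $ 2 $ 3 = 0"
  "strict_lower a b c $ 3 $ 1 = c" "strict_lower a b c $ 3 $ 2 = b" "strict_lower a b c $ 3 $ 3 = 0"
  by (simp_all add: strict_lower_def vec_eq_iff forall_3)

lemma mat3_eq_iff:
  fixes A B :: "'a^3^3"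
  shows "A = B \<longleftrightarrow> A$1$1 = B$1$1 \<and> A$1$2 = B$1$2 \<and> A$1$3 = B$1$3 \<and>
     A$2$1 = B$2$1 \<and> A$2$2 = B$2$2 \<and> A$2$3 = B$2$3 \<and>
     A$3$1 = B$3$1 \<and> A$3$2 = B$3$2 \<and> A$3$3 = B$3$3"
  by (auto simp: vec_eq_iff forall_3)

lemma mat3_mult_entry:
  fixes A B :: "'a::semiring_1^3^3"
  shows "(A ** B) $ i $ j = A$i$1 * B$1$j + A$i$2 * B$2$j + A$i$3 * B$3$j"
  by (simp add: matrix_matrix_mult_def sum_3)

lemma strict_lower_mult:
  "strict_lower a b c ** strict_lower a' b' c' = strict_lower 0 0 (b * a')"
  by (simp add: mat3_eq_iff mat3_mult_entry)

lemma strict_lower_add: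
  "strict_lower a b c + strict_lower a' b' c' = strict_lower (a + a') (b + b') (c + c')"
  by (simp add: mat3_eq_iff)

lemma mscale_strict_lower:
  "k *\<^sub>m strict_lower a b c = strict_lower (k * a) (k * b) (k * c)"
  by (simp add: mat3_eq_iff mscale_def)

lemma zero_strict_lower: "0 = strict_lower 0 0 0"
  by (simp add: mat3_eq_iff)

lemma E_unit_strict_lower:
  "E_unit 2 1 = strict_lower 1 0 0" "E_unit 3 2 = strict_lower 0 1 0"
  "E_unit 3 1 = strict_lower 0 0 1"
  by (simp_all add: mat3_eq_iff E_unit_def)

lemma representative_strict_lower:
  "representative (A_ff l m) = (strict_lower 1 1 0, strict_lower l (l + m) 0)"
  "representative (A_fi l) = (strict_lower 1 0 0, strict_lower l 1 0)"
  "representative (A_if l) = (strict_lower 0 1 0, strict_lower 1 l 0)"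
  "representative (B_ff l m) = (strict_lower 1 1 0, strict_lower l l m)"
  "representative (B_if l) = (strict_lower 0 0 l, strict_lower 1 1 0)"
  "representative C_lab = (strict_lower 1 0 0, strict_lower 0 0 1)"
  "representative D_lab = (strict_lower 0 0 1, strict_lower 0 1 0)"
  "representative (E_f l) = (strict_lower 1 0 0, strict_lower l 0 0)"
  "representative E_i = (strict_lower 0 0 0, strict_lower 1 0 0)"
  "representative O_lab = (strict_lower 0 0 0, strict_lower 0 0 0)"
  by (simp_all add: E_unit_strict_lower strict_lower_add mscale_strict_lower
      flip: zero_strict_lower)

lemma strict_lower_intertwiner_iff:
  "strict_lower a' b' c' ** g = g ** strict_lower a b c \<longleftrightarrow>
     a * g$1$2 + c * g$1$3 = 0 \<and> b * g$1$3 = 0 \<and>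
     a' * g$1$1 = a * g$2$2 + c * g$2$3 \<and> a' * g$1$2 = b * g$2$3 \<and> a' * g$1$3 = 0 \<and>
     c' * g$1$1 + b' * g$2$1 = a * g$3$2 + c * g$3$3 \<and>
     c' * g$1$2 + b' * g$2$2 = b * g$3$3 \<and> c' * g$1$3 + b' * g$2$3 = 0"
  by (auto simp: mat3_eq_iff mat3_mult_entry mult.commute)

text \<open>The strictly lower triangular matrices form an algebra containing the pair, hence also the
  algebra that the pair generates, and any three of them have product zero.\<close>

lemma strict_lower_pair_in_nullcone:
  "(strict_lower a b c, strict_lower a' b' c') \<in> (nullcone2 :: (('k::field^3^3) \<times> ('k^3^3)) set)"
proof -
  let ?X = "{strict_lower a b c, strict_lower a' b' c'}"
  let ?T = "{strict_lower x y z :: 'k^3^3 | x y z. True}"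
  have "nonunital_subalgebra ?T"
    unfolding nonunital_subalgebra_def
  proof (intro conjI ballI allI)
    show "0 \<in> ?T" using zero_strict_lower by blast
  qed (auto simp: strict_lower_add mscale_strict_lower strict_lower_mult, blast+)
  then have hull: "nonunital_subalgebra hull ?X \<subseteq> ?T"
    by (intro hull_minimal) auto
  have "foldr (**) As (mat 1) = 0" if "length As = 3" "set As \<subseteq> ?T" for As
  proof -
    from that(1) obtain P Q R where "As = [P, Q, R]"
      by (auto simp: numeral_3_eq_3 length_Suc_conv)
    with that(2) show ?thesis
      by (auto simp: strict_lower_mult matrix_mul_assoc simp flip: zero_strict_lower)
  qed
  then have "nilpotent_algebra (nonunital_subalgebra hull ?X)"
    unfolding nilpotent_algebra_def using hull by (metis (no_types, lifting) subset_trans)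
  then show ?thesis
    by (simp add: nullcone2_def)
qed

text \<open>All the information lies in the entry equations of an intertwining matrix \<open>g\<close>. Products of
  members of a strictly lower triangular pair are \<open>A\<^sub>i A\<^sub>j = b\<^sub>i a\<^sub>j E\<^sub>3\<^sub>1\<close>. For the families \<open>A\<close>
  and \<open>B\<close> one of them is nonzero; this forces \<open>g\<close> to be lower triangular, so the directions of
  \<open>a\<close> and \<open>b\<close>, and for equal directions the class of \<open>c\<close> modulo \<open>a\<close>, can be read off. For the
  other representatives all products vanish: the linear relations between the two
  matrices tell \<open>O\<close> and the members of the family \<open>E\<close> from each other and from \<open>C\<close> and \<open>D\<close>, and the
  common kernel has dimension two for \<open>C\<close> but one for \<open>D\<close>.\<close>

lemma representative_distinct:
  fixes p q :: "'k::field label"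
  assumes "admissible p" "admissible q" "representative p \<in> GL_orbit (representative q)"
  shows "p = q"
proof -
  obtain g where g: "det g \<noteq> 0"
    "fst (representative p) ** g = g ** fst (representative q)"
    "snd (representative p) ** g = g ** snd (representative q)"
    using assms(3) unfolding GL_orbit_iff invertible_det_nz by blast
  show ?thesis
    using g assms(1,2)
    by (cases p; cases q)
      (simp_all add: representative_strict_lower strict_lower_intertwiner_iff det_3
        del: representative.simps)
qed

section \<open>Normal forms of strictly lower triangular pairs\<close>

lemma det_mat3_vector:
  "det (vector [vector [a, b, c], vector [d, e, f], vector [x, y, z]] :: 'k::field^3^3) =
    a * e * z + b * f * x + c * d * y - a * f * y - b * d * z - c * e * x"
  by (simp add: det_3)

lemma strict_lower_orbitI:
  fixes g :: "'k::field^3^3"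
  assumes "det g \<noteq> 0"
    and "strict_lower a1' b1' c1' ** g = g ** strict_lower a1 b1 c1"
    and "strict_lower a2' b2' c2' ** g = g ** strict_lower a2 b2 c2"
  shows "(strict_lower a1' b1' c1', strict_lower a2' b2' c2') \<in>
    GL_orbit (strict_lower a1 b1 c1, strict_lower a2 b2 c2)"
  unfolding GL_orbit_iff invertible_det_nz using assms by auto

text \<open>The conjugating matrix has diagonal \<open>p, q, r\<close> and subdiagonal \<open>s, t\<close>. Its lower left entry
  can be taken to be zero because it does not enter the intertwining equations.\<close>

lemma strict_lower_pair_triangular_orbitI:
  fixes p q r s t :: "'k::field"
  assumes "p \<noteq> 0" "q \<noteq> 0" "r \<noteq> 0"
    and "a1' * p = a1 * q" "a2' * p = a2 * q"
    and "b1' * q = b1 * r" "b2' * q = b2 * r"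
    and "c1' * p + b1' * s = a1 * t + c1 * r" "c2' * p + b2' * s = a2 * t + c2 * r"
  shows "(strict_lower a1' b1' c1', strict_lower a2' b2' c2') \<in>
    GL_orbit (strict_lower a1 b1 c1, strict_lower a2 b2 c2)"
  by (rule strict_lower_orbitI
        [of "vector [vector [p, 0, 0], vector [s, q, 0], vector [0, t, r]]"])
    (use assms in \<open>simp_all add: det_mat3_vector strict_lower_intertwiner_iff\<close>)

lemma strict_lower_pair_shear_orbitI:
  fixes s t :: "'k::field"
  assumes "c1' + b1 * s = a1 * t + c1" "c2' + b2 * s = a2 * t + c2"
  shows "(strict_lower a1 b1 c1', strict_lower a2 b2 c2') \<in>
    GL_orbit (strict_lower a1 b1 c1, strict_lower a2 b2 c2)"
  by (rule strict_lower_pair_triangular_orbitI[where p = 1 and q = 1 and r = 1 and s = s and t = t])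
    (use assms in simp_all)

text \<open>Normalized homogeneous coordinates of a point of the projective line: \<open>(1, \<lambda>)\<close> for a finite
  \<open>\<lambda>\<close>, and \<open>(0, 1)\<close> for the point at infinity.\<close>

definition direction :: "'k::field \<Rightarrow> 'k \<Rightarrow> bool"
  where "direction u v \<longleftrightarrow> u = 1 \<or> u = 0 \<and> v = 1"

lemma obtain_direction:
  fixes x y :: "'k::field"
  assumes "x \<noteq> 0 \<or> y \<noteq> 0"
  obtains k u v where "k \<noteq> 0" "x = k * u" "y = k * v" "direction u v"
proof (cases "x = 0")
  case True
  then show ?thesis
    using assms that[of y 0 1] by (simp add: direction_def)
next
  case False
  then show ?thesis
    using that[of x 1 "y / x"] by (simp add: direction_def)
qed

text \<open>The shears change \<open>c\<close> by any combination of \<open>a\<close> and \<open>b\<close>. Two distinct directions span the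
  plane, so then \<open>c\<close> can be cleared; for a common direction \<open>a = b\<close>, one coordinate of \<open>c\<close> can be
  cleared: the first one if \<open>a = (1, \<lambda>)\<close>, the second one if \<open>a = (0, 1)\<close>.\<close>

lemma normal_form_directions:
  fixes c1 c2 :: "'k::field"
  assumes "direction a1 a2" "direction b1 b2"
  shows "\<exists>p. admissible p \<and>
    representative p \<in> GL_orbit (strict_lower a1 b1 c1, strict_lower a2 b2 c2)"
proof -
  consider (11) l r where "a1 = 1" "a2 = l" "b1 = 1" "b2 = r"
    | (10) l where "a1 = 1" "a2 = l" "b1 = 0" "b2 = 1"
    | (01) l where "a1 = 0" "a2 = 1" "b1 = 1" "b2 = l"
    | (00) "a1 = 0" "a2 = 1" "b1 = 0" "b2 = 1"
    using assms unfolding direction_def by blast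
  then show ?thesis
  proof cases
    case (11 l r)
    show ?thesis
    proof (cases "l = r")
      case True
      have "representative (B_ff l (c2 - l * c1)) \<in>
          GL_orbit (strict_lower a1 b1 c1, strict_lower a2 b2 c2)"
        unfolding representative_strict_lower 11 True
        by (intro strict_lower_pair_shear_orbitI[where s = c1 and t = 0]) auto
      then show ?thesis
        by (metis admissible.simps)
    next
      case False
      \<comment> \<open>Clearing \<open>c\<close> means solving \<open>s - t = c1\<close> and \<open>r s - l t = c2\<close>.\<close>
      define s where "s = (c2 - l * c1) / (r - l)"
      have "(r - l) * s = c2 - l * c1"
        using False by (simp add: s_def)
      then have "representative (A_ff l (r - l)) \<in>
          GL_orbit (strict_lower a1 b1 c1, strict_lower a2 b2 c2)"
        unfolding representative_strict_lower 11 add_diff_cancel_left' add_diff_eq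
        by (intro strict_lower_pair_shear_orbitI[where s = s and t = "s - c1"])
          (auto simp: algebra_simps)
      then show ?thesis
        using False by (metis admissible.simps(1) right_minus_eq)
    qed
  next
    case (10 l)
    have "representative (A_fi l) \<in> GL_orbit (strict_lower a1 b1 c1, strict_lower a2 b2 c2)"
      unfolding representative_strict_lower 10
      by (intro strict_lower_pair_shear_orbitI[where s = "c2 - l * c1" and t = "- c1"])
        auto
    then show ?thesis
      by (metis admissible.simps)
  next
    case (01 l)
    have "representative (A_if l) \<in> GL_orbit (strict_lower a1 b1 c1, strict_lower a2 b2 c2)"
      unfolding representative_strict_lower 01
      by (intro strict_lower_pair_shear_orbitI[where s = c1 and t = "l * c1 - c2"])
        auto
    then show ?thesis
      by (metis admissible.simps)
  next
    case 00
    have "representative (B_if c1) \<in> GL_orbit (strict_lower a1 b1 c1, strict_lower a2 b2 c2)"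
      unfolding representative_strict_lower 00
      by (intro strict_lower_pair_shear_orbitI[where s = c2 and t = 0]) auto
    then show ?thesis
      by (metis admissible.simps)
  qed
qed

lemma normal_form_generic:
  fixes a1 a2 b1 b2 c1 c2 :: "'k::field"
  assumes "a1 \<noteq> 0 \<or> a2 \<noteq> 0" "b1 \<noteq> 0 \<or> b2 \<noteq> 0"
  shows "\<exists>p. admissible p \<and>
    representative p \<in> GL_orbit (strict_lower a1 b1 c1, strict_lower a2 b2 c2)"
proof -
  obtain k u1 u2 where u: "k \<noteq> 0" "a1 = k * u1" "a2 = k * u2" "direction u1 u2"
    using obtain_direction[OF assms(1)] .
  obtain m v1 v2 where v: "m \<noteq> 0" "b1 = m * v1" "b2 = m * v2" "direction v1 v2"
    using obtain_direction[OF assms(2)] .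
  have "(strict_lower u1 v1 (c1 / (k * m)), strict_lower u2 v2 (c2 / (k * m))) \<in>
      GL_orbit (strict_lower a1 b1 c1, strict_lower a2 b2 c2)"
    by (rule strict_lower_pair_triangular_orbitI
          [where p = "k * m" and q = m and r = 1 and s = 0 and t = 0])
      (use u v in auto)
  then show ?thesis
    using normal_form_directions[OF u(4) v(4)] GL_orbit_trans by blast
qed

lemma representative_E:
  assumes "direction u v"
  shows "\<exists>p. admissible p \<and> representative p = (strict_lower u 0 0, strict_lower v 0 0)"
  using assms unfolding direction_def
  by (metis admissible.simps(8,9) representative_strict_lower(8,9))

text \<open>The rows of a nonzero singular \<open>2 \<times> 2\<close> matrix are multiples of one normalized vector.\<close>

lemma proportional:
  fixes x1 x2 y1 y2 :: "'k::field"
  assumes "x1 * y2 = x2 * y1" and "\<not> (x1 = 0 \<and> x2 = 0 \<and> y1 = 0 \<and> y2 = 0)"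
  obtains \<alpha> \<gamma> u v where "\<alpha> \<noteq> 0 \<or> \<gamma> \<noteq> 0" "direction u v"
    "x1 = \<alpha> * u" "x2 = \<alpha> * v" "y1 = \<gamma> * u" "y2 = \<gamma> * v"
proof (cases "x1 = 0 \<and> x2 = 0")
  case True
  then show ?thesis
    using assms(2) obtain_direction[of y1 y2] that[of 0] by (metis mult_zero_left)
next
  case False
  then obtain k u v where k: "k \<noteq> 0" "x1 = k * u" "x2 = k * v" "direction u v"
    using obtain_direction by metis
  then have "u * y2 = v * y1"
    using assms(1) by simp
  with k(4) have "\<exists>\<gamma>. y1 = \<gamma> * u \<and> y2 = \<gamma> * v"
    unfolding direction_def by (auto simp: mult.commute)
  then show ?thesis
    using that k by blast
qed

text \<open>Block diagonal matrices with blocks of size one and two act on the column \<open>(a, c)\<close> by left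
  multiplication, up to a scalar from the first block. If \<open>a\<close> and \<open>c\<close> are independent, the
  inverse of the matrix with rows \<open>a\<close> and \<open>c\<close>
  brings the pair to \<open>C\<close>; if they are multiples \<open>\<alpha>\<close> and \<open>\<gamma>\<close> of one vector, it suffices to move
  \<open>(\<alpha>, \<gamma>)\<close> to the first unit vector.\<close>

lemma normal_form_left_column:
  fixes a1 a2 c1 c2 :: "'k::field"
  shows "\<exists>p. admissible p \<and>
    representative p \<in> GL_orbit (strict_lower a1 0 c1, strict_lower a2 0 c2)"
proof (cases "a1 * c2 = a2 * c1")
  case False
  define d where "d = a1 * c2 - a2 * c1"
  have d: "d \<noteq> 0" "a1 * c2 - a2 * c1 = d" "c2 * a1 - c1 * a2 = d"
    using False by (auto simp: d_def)
  have "representative C_lab \<in> GL_orbit (strict_lower a1 0 c1, strict_lower a2 0 c2)"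
    unfolding representative_strict_lower
    by (rule strict_lower_orbitI
          \<comment> \<open>The block is the adjugate matrix; the corner \<open>d\<close> compensates for its
            missing denominator.\<close>
          [of "vector [vector [d, 0, 0], vector [0, c2, - a2], vector [0, - c1, a1]]"])
      (use d in \<open>simp_all add: det_mat3_vector strict_lower_intertwiner_iff algebra_simps\<close>)
  then show ?thesis
    by (metis admissible.simps)
next
  case True
  show ?thesis
  proof (cases "a1 = 0 \<and> a2 = 0 \<and> c1 = 0 \<and> c2 = 0")
    case True
    then have "representative O_lab \<in> GL_orbit (strict_lower a1 0 c1, strict_lower a2 0 c2)"
      unfolding representative_strict_lower using GL_orbit_refl by blast
    then show ?thesis
      by (metis admissible.simps)
  next
    case False
    obtain \<alpha> \<gamma> u v where uv: "\<alpha> \<noteq> 0 \<or> \<gamma> \<noteq> 0" "direction u v"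
        "a1 = \<alpha> * u" "a2 = \<alpha> * v" "c1 = \<gamma> * u" "c2 = \<gamma> * v"
      using proportional[OF True False] .
    have "(strict_lower u 0 0, strict_lower v 0 0) \<in>
        GL_orbit (strict_lower a1 0 c1, strict_lower a2 0 c2)"
    proof (cases "\<alpha> = 0")
      case True
      show ?thesis
        by (rule strict_lower_orbitI
              [of "vector [vector [\<gamma>, 0, 0], vector [0, 0, 1], vector [0, 1, 0]]"])
          (use uv True in \<open>simp_all add: det_mat3_vector strict_lower_intertwiner_iff\<close>)
    next
      case False
      show ?thesis
        by (rule strict_lower_orbitI
              [of "vector [vector [\<alpha>, 0, 0], vector [0, 1, 0], vector [0, - \<gamma>, \<alpha>]]"])
          (use uv False in \<open>simp_all add: det_mat3_vector strict_lower_intertwiner_iff\<close>)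
    qed
    then show ?thesis
      using representative_E[OF uv(2)] by metis
  qed
qed

text \<open>Here the row \<open>(c, b)\<close> is acted on from the right. In the rank one case the target is
  \<open>E\<close>, whose nonzero entries stand in the second row, so the conjugating matrix must
  also interchange the last two coordinates.\<close>

lemma normal_form_bottom_row:
  fixes b1 b2 c1 c2 :: "'k::field"
  shows "\<exists>p. admissible p \<and>
    representative p \<in> GL_orbit (strict_lower 0 b1 c1, strict_lower 0 b2 c2)"
proof (cases "b1 * c2 = b2 * c1")
  case False
  have "representative D_lab \<in> GL_orbit (strict_lower 0 b1 c1, strict_lower 0 b2 c2)"
    unfolding representative_strict_lower
    by (rule strict_lower_orbitI
          [of "vector [vector [c1, b1, 0], vector [c2, b2, 0], vector [0, 0, 1]]"])
      (use False in \<open>auto simp add: det_mat3_vector strict_lower_intertwiner_iff algebra_simps\<close>)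
  then show ?thesis
    by (metis admissible.simps)
next
  case True
  show ?thesis
  proof (cases "b1 = 0 \<and> b2 = 0 \<and> c1 = 0 \<and> c2 = 0")
    case True
    then have "representative O_lab \<in> GL_orbit (strict_lower 0 b1 c1, strict_lower 0 b2 c2)"
      unfolding representative_strict_lower using GL_orbit_refl by blast
    then show ?thesis
      by (metis admissible.simps)
  next
    case False
    obtain \<beta> \<gamma> u v where uv: "\<beta> \<noteq> 0 \<or> \<gamma> \<noteq> 0" "direction u v"
        "b1 = \<beta> * u" "b2 = \<beta> * v" "c1 = \<gamma> * u" "c2 = \<gamma> * v"
      using proportional[OF True False] .
    have "(strict_lower u 0 0, strict_lower v 0 0) \<in>
        GL_orbit (strict_lower 0 b1 c1, strict_lower 0 b2 c2)"
    proof (cases "\<beta> = 0")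
      case True
      show ?thesis
        by (rule strict_lower_orbitI
              [of "vector [vector [\<gamma>, 0, 0], vector [0, 0, 1], vector [0, 1, 0]]"])
          (use uv True in \<open>simp_all add: det_mat3_vector strict_lower_intertwiner_iff\<close>)
    next
      case False
      show ?thesis
        by (rule strict_lower_orbitI
              [of "vector [vector [\<gamma>, \<beta>, 0], vector [0, 0, 1], vector [1, 0, 0]]"])
          (use uv False in \<open>simp_all add: det_mat3_vector strict_lower_intertwiner_iff\<close>)
    qed
    then show ?thesis
      using representative_E[OF uv(2)] by metis
  qed
qed

lemma normal_form:
  fixes a1 a2 b1 b2 c1 c2 :: "'k::field"
  shows "\<exists>p. admissible p \<and>
    representative p \<in> GL_orbit (strict_lower a1 b1 c1, strict_lower a2 b2 c2)"
  using normal_form_generic normal_form_left_column normal_form_bottom_row by metis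

section \<open>Triangularization of the nullcone\<close>

text \<open>Let \<open>P\<close> be a nonzero product with as many factors as possible: any further factor, on
  either side, makes it zero. As some element of \<open>S\<close> is nonzero, \<open>P\<close> is not the empty product,
  so \<open>P\<^sup>2\<close> extends \<open>P\<close> by at least one factor and vanishes.\<close>

lemma nilpotent_algebra_square_zero_annihilator:
  fixes S :: "('k::field^'n^'n) set"
  assumes nil: "nilpotent_algebra S" and nz: "B \<in> S" "B \<noteq> 0"
  obtains P where "P \<noteq> 0" "P ** P = 0"
    "\<And>A. A \<in> S \<Longrightarrow> A ** P = 0" "\<And>A. A \<in> S \<Longrightarrow> P ** A = 0"
proof -
  let ?prod = "\<lambda>As. foldr (**) As (mat 1 :: 'k^'n^'n)"
  let ?Q = "\<lambda>n. \<forall>As. length As = n \<and> set As \<subseteq> S \<longrightarrow> ?prod As = 0"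
  define n where "n = (LEAST n. ?Q n)"
  have zero: "?prod As = 0" if "length As = n" "set As \<subseteq> S" for As
    using LeastI_ex[of ?Q] nil that unfolding nilpotent_algebra_def n_def by blast
  have prod_append: "?prod (As @ Bs) = ?prod As ** ?prod Bs" for As Bs
    by (induction As) (simp_all add: matrix_mul_assoc)
  have "mat 1 \<noteq> (0 :: 'k^'n^'n)"
    by (metis nz(2) matrix_mul_lid times0_left)
  then obtain m where m: "n = Suc m"
    using zero[of "[]"] by (cases n) auto
  then obtain Ps where Ps: "length Ps = m" "set Ps \<subseteq> S" "?prod Ps \<noteq> 0"
    using not_less_Least[of m ?Q] unfolding n_def by auto
  have left: "A ** ?prod Ps = 0" if "A \<in> S" for A
    using zero[of "A # Ps"] Ps m that by simp
  have right: "?prod Ps ** A = 0" if "A \<in> S" for A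
    using zero[of "Ps @ [A]"] prod_append[of Ps "[A]"] Ps m that by simp
  have "?prod Ps ** ?prod Ps = 0"
  proof (cases Ps)
    case Nil
    \<comment> \<open>The empty product is the identity, so \<open>right\<close> would make the nonzero \<open>B\<close> vanish.\<close>
    then show ?thesis
      using right nz by simp
  next
    case (Cons A As)
    then show ?thesis
      using right[of A] Ps(2)
      by simp (metis matrix_mul_assoc times0_left)
  qed
  with Ps left right show ?thesis
    using that by blast
qed

lemma exists_dual_vector:
  fixes v :: "'k::field^3"
  assumes "v \<noteq> 0"
  shows "\<exists>r :: 'k^3. r$1 * v$1 + r$2 * v$2 + r$3 * v$3 = 1"
proof -
  consider "v$1 \<noteq> 0" | "v$2 \<noteq> 0" | "v$3 \<noteq> 0"
    using assms by (auto simp: vec_eq_iff forall_3)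
  then show ?thesis
  proof cases
    case 1
    then show ?thesis by (intro exI[of _ "vector [1 / v$1, 0, 0]"]) simp
  next
    case 2
    then show ?thesis by (intro exI[of _ "vector [0, 1 / v$2, 0]"]) simp
  next
    case 3
    then show ?thesis by (intro exI[of _ "vector [0, 0, 1 / v$3]"]) simp
  qed
qed

text \<open>The rows of \<open>g\<close> are \<open>u\<close>, a vector orthogonal to \<open>v\<close>, and a vector \<open>r\<close> dual to \<open>v\<close>. The
  middle row is obtained from a vector \<open>w\<close> by subtracting a multiple of \<open>r\<close>, which leaves
  the determinant equal to the product of \<open>w\<close> with \<open>n = r \<times> u\<close>. The triple product
  expansion of \<open>v \<times> (r \<times> u)\<close> gives \<open>- u\<close>, so \<open>n\<close> is nonzero and \<open>w\<close> can be chosen with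
  product one.\<close>

lemma obtain_adapted_basis:
  fixes u v :: "'k::field^3"
  assumes nz: "u \<noteq> 0" "v \<noteq> 0" and orth: "u$1 * v$1 + u$2 * v$2 + u$3 * v$3 = 0"
  obtains g :: "'k^3^3" where "invertible g" "g $ 1 = u" "g *v v = axis 3 1"
proof -
  obtain r :: "'k^3" where r: "r$1 * v$1 + r$2 * v$2 + r$3 * v$3 = 1"
    using exists_dual_vector[OF nz(2)] by blast
  define n :: "'k^3" where
    "n = vector [r$2 * u$3 - r$3 * u$2, r$3 * u$1 - r$1 * u$3, r$1 * u$2 - r$2 * u$1]"
  have triple: "u = vector [v$3 * n$2 - v$2 * n$3, v$1 * n$3 - v$3 * n$1, v$2 * n$1 - v$1 * n$2]"
  proof -
    have "v$3 * n$2 - v$2 * n$3 = u$1" "v$1 * n$3 - v$3 * n$1 = u$2" "v$2 * n$1 - v$1 * n$2 = u$3"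
      unfolding n_def vector_3 using r orth by algebra+
    then show ?thesis by (simp add: vec_eq_iff forall_3)
  qed
  have "n \<noteq> 0"
  proof
    assume "n = 0"
    with triple have "u = 0" by (simp add: vec_eq_iff forall_3)
    with nz(1) show False by simp
  qed
  then obtain w :: "'k^3" where w: "w$1 * n$1 + w$2 * n$2 + w$3 * n$3 = 1"
    using exists_dual_vector by blast
  define k where "k = w$1 * v$1 + w$2 * v$2 + w$3 * v$3"
  define g :: "'k^3^3" where
    "g = vector [u, vector [w$1 - k * r$1, w$2 - k * r$2, w$3 - k * r$3], r]"
  have "det g = 1"
    using w unfolding det_3 g_def n_def vector_3 by algebra
  then have "invertible g"
    by (simp add: invertible_det_nz)
  moreover have "(w$1 - k * r$1) * v$1 + (w$2 - k * r$2) * v$2 + (w$3 - k * r$3) * v$3 = 0"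
    using r unfolding k_def by algebra
  then have "g *v v = axis 3 1"
    using r orth by (simp add: g_def vec_eq_iff forall_3 matrix_vector_mult_def sum_3 axis_def)
  ultimately show ?thesis
    using that by (simp add: g_def)
qed

lemma power_intertwines:
  fixes g X Y :: "'k::field^'n^'n"
  assumes "Y ** g = g ** X"
  shows "foldr (**) (replicate m Y) (mat 1) ** g = g ** foldr (**) (replicate m X) (mat 1)"
proof (induction m)
  case (Suc m)
  then show ?case
    using assms by simp (metis matrix_mul_assoc)
qed simp

text \<open>Such a \<open>Y\<close> is lower triangular, and the diagonal entries of a power of a triangular matrix are
  the powers of its diagonal entries. The upper entry is carried along because it is what the
  induction step multiplies with \<open>Y $ 2 $ 1\<close>.\<close>

lemma power_middle_entry:
  fixes Y :: "'k::field^3^3"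
  assumes "Y $ 1 = 0" "Y $ 2 $ 3 = 0"
  shows "foldr (**) (replicate m Y) (mat 1) $ 1 $ 2 = 0 \<and>
    foldr (**) (replicate m Y) (mat 1) $ 2 $ 2 = (Y $ 2 $ 2) ^ m"
  by (induction m) (simp_all add: mat3_mult_entry assms mat_def)

lemma nullcone_triangularizable:
  fixes X1 X2 :: "'k::field^3^3"
  assumes "(X1, X2) \<in> nullcone2"
  shows "\<exists>a1 b1 c1 a2 b2 c2.
    (strict_lower a1 b1 c1, strict_lower a2 b2 c2) \<in> GL_orbit (X1, X2)"
proof (cases "X1 = 0 \<and> X2 = 0")
  case True
  then show ?thesis
    using GL_orbit_refl zero_strict_lower by metis
next
  case False
  define S where "S = nonunital_subalgebra hull {X1, X2}"
  have nil: "nilpotent_algebra S"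
    using assms by (simp add: nullcone2_def S_def)
  have X: "X1 \<in> S" "X2 \<in> S"
    by (simp_all add: S_def hull_inc)
  obtain B where "B \<in> S" "B \<noteq> 0"
    using False X by blast
  then obtain P where P: "P \<noteq> 0" "P ** P = 0"
      "\<And>A. A \<in> S \<Longrightarrow> A ** P = 0" "\<And>A. A \<in> S \<Longrightarrow> P ** A = 0"
    using nilpotent_algebra_square_zero_annihilator[OF nil] by metis
  obtain i j where ij: "P $ i $ j \<noteq> 0"
    using P(1) by (auto simp: vec_eq_iff)
  obtain g :: "'k^3^3" where g: "invertible g" "g $ 1 = P $ i" "g *v column j P = axis 3 1"
  proof (rule obtain_adapted_basis[of "P $ i" "column j P"])
    show "P $ i \<noteq> 0" "column j P \<noteq> 0"
      using ij by (auto simp: column_def vec_eq_iff)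
    show "P$i$1 * column j P $ 1 + P$i$2 * column j P $ 2 + P$i$3 * column j P $ 3 = 0"
      using mat3_mult_entry[of P P i j] P(2) by (simp add: column_def)
  qed
  have "\<exists>a b c. strict_lower a b c ** g = g ** A" if A: "A \<in> S" for A
  proof -
    define Y where "Y = g ** A ** matrix_inv g"
    have Y: "Y ** g = g ** A"
      using matrix_inv_inverse[OF g(1)] by (metis Y_def matrix_mul_assoc matrix_mul_rid)
    have "(g ** A) $ 1 = (P ** A) $ i"
      by (simp add: vec_eq_iff mat3_mult_entry g(2))
    then have row: "Y $ 1 = 0"
      using P(4)[OF A] by (simp add: Y_def vec_eq_iff mat3_mult_entry)
    have "A *v column j P = column j (A ** P)"
      by (simp add: vec_eq_iff column_def matrix_vector_mult_def matrix_matrix_mult_def)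
    also have "\<dots> = 0"
      using P(3)[OF A] by (simp add: column_def vec_eq_iff)
    finally have "Y *v axis 3 1 = 0"
      using Y g(3) by (metis matrix_vector_mul_assoc matrix_vector_mult_0_right)
    then have col: "Y $ k $ 3 = 0" for k
      by (simp add: vec_eq_iff matrix_vector_mult_def sum_3 axis_def)
    obtain m where "foldr (**) (replicate m A) (mat 1) = 0"
      using nil A unfolding nilpotent_algebra_def
      by (metis length_replicate set_replicate_conv_if empty_subsetI insert_subset)
    then have "foldr (**) (replicate m Y) (mat 1) ** g = 0"
      using power_intertwines[OF Y] by (simp add: matrix_matrix_mult_def vec_eq_iff)
    then have "foldr (**) (replicate m Y) (mat 1) ** (g ** matrix_inv g) = 0"
      by (simp add: matrix_mul_assoc times0_left)
    then have "foldr (**) (replicate m Y) (mat 1) = 0"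
      by (simp add: matrix_inv_inverse(1)[OF g(1)])
    then have "Y $ 2 $ 2 = 0"
      using power_middle_entry[OF row col, of m] by simp
    with row col have "Y = strict_lower (Y$2$1) (Y$3$2) (Y$3$1)"
      by (simp add: mat3_eq_iff)
    with Y show ?thesis
      by metis
  qed
  then show ?thesis
    using X g(1) unfolding GL_orbit_iff by (metis fst_conv snd_conv)
qed

theorem proposition4p2:
  shows "representative ` {p :: 'k label. admissible p}
        \<subseteq> (nullcone2 :: (('k::alg_closed_field^3^3) \<times> ('k^3^3)) set)
    \<and> (\<forall>X \<in> (nullcone2 :: (('k^3^3) \<times> ('k^3^3)) set).
          \<exists>!Y. Y \<in> representative ` {p. admissible p} \<and> Y \<in> GL_orbit X)
    \<and> (\<forall>p q :: 'k label. admissible p \<and> admissible q \<and> p \<noteq> q \<longrightarrow>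
          GL_orbit (representative p) \<noteq> GL_orbit (representative q))"
proof (intro conjI ballI allI impI)
  show "representative ` {p :: 'k label. admissible p} \<subseteq> nullcone2"
  proof (rule image_subsetI)
    fix p :: "'k label"
    show "representative p \<in> nullcone2"
      by (cases p)
        (simp_all only: representative_strict_lower strict_lower_pair_in_nullcone)
  qed
next
  fix X :: "('k^3^3) \<times> ('k^3^3)"
  assume "X \<in> nullcone2"
  then obtain a1 b1 c1 a2 b2 c2 where
      L: "(strict_lower a1 b1 c1, strict_lower a2 b2 c2) \<in> GL_orbit X"
    using nullcone_triangularizable[of "fst X" "snd X"] by auto
  obtain p where p: "admissible p"
      "representative p \<in> GL_orbit (strict_lower a1 b1 c1, strict_lower a2 b2 c2)"
    using normal_form by blast
  have pX: "representative p \<in> GL_orbit X"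
    using p(2) L by (rule GL_orbit_trans)
  show "\<exists>!Y. Y \<in> representative ` {p. admissible p} \<and> Y \<in> GL_orbit X"
  proof (rule ex1I)
    show "representative p \<in> representative ` {p. admissible p} \<and> representative p \<in> GL_orbit X"
      using p(1) pX by blast
  next
    fix Y
    assume "Y \<in> representative ` {p. admissible p} \<and> Y \<in> GL_orbit X"
    then obtain q where q: "admissible q" "Y = representative q" "Y \<in> GL_orbit X"
      by blast
    then have "representative q \<in> GL_orbit (representative p)"
      using pX GL_orbit_sym GL_orbit_trans by blast
    then show "Y = representative p"
      using representative_distinct p(1) q(1,2) by blast
  qed
next
  fix p q :: "'k label"
  assume "admissible p \<and> admissible q \<and> p \<noteq> q"
  then show "GL_orbit (representative p) \<noteq> GL_orbit (representative q)"
    using representative_distinct GL_orbit_refl by metis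
qed

end
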